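(* Let $D\subset\mathbb{C}^n$ be a bounded pseudoconvex domain with coordinates $z=(z_1,\dots,z_n)$, let $\omega=\sqrt{-1}\,\partial\overline{\partial}|z|^2$ be the standard Kähler metric on $D$, let $1\le q\le n$, and let $c\ge0$ be a constant. Let $\varphi$ be a smooth real-valued function on $D$. Suppose there exists a sequence $\{\varphi_j\}_{j=1}^\infty$ of smooth real-valued functions on $D$ decreasing to $\varphi$ pointwise such that, for every $j$, at every point of $D$ the sum of any $q$ distinct eigenvalues (counted with multiplicity) of $\sqrt{-1}\,\partial\overline{\partial}\varphi_j$ with respect to $\omega$ is greater than or equal to $c$. Then at every point of $D$ the sum of any $q$ distinct eigenvalues (counted with multiplicity) of $\sqrt{-1}\,\partial\overline{\partial}\varphi$ with respect to $\omega$ is greater than or equal to $c$.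
   Context: Here $\omega=\sqrt{-1}\sum_j dz_j\wedge d\bar z_j$. The eigenvalues of $\sqrt{-1}\,\partial\overline{\partial}\varphi$ with respect to $\omega$ at a point are the eigenvalues $\gamma_1,\dots,\gamma_n$ of the Hermitian matrix $\big(\partial^2\varphi/\partial z_j\partial\bar z_k\big)_{j,k}$ at that point. "The sum of any $q$ distinct eigenvalues (counted with multiplicity)" means $\gamma_{i_1}+\dots+\gamma_{i_q}$ for any indices $i_1<\dots<i_q$. *)

theory Defs
  imports
    "HOL-Analysis.Analysis"
    "HOL-Computational_Algebra.Polynomial"
begin

section \<open>Smooth functions\<close>

text \<open>
  \<open>Ck_on k D f\<close> is meant for open \<open>D\<close>: all iterated directional derivatives of \<open>f\<close> up to
  order \<open>k\<close> exist and are continuous on \<open>D\<close>.  Derivatives are over the reals; values of \<open>f\<close>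
  outside \<open>D\<close> are irrelevant.
\<close>

fun Ck_on :: "nat \<Rightarrow> 'a::real_normed_vector set \<Rightarrow> ('a \<Rightarrow> real) \<Rightarrow> bool" where
  "Ck_on 0 D f \<longleftrightarrow> continuous_on D f"
| "Ck_on (Suc k) D f \<longleftrightarrow>
     (\<forall>x\<in>D. f differentiable (at x)) \<and>
     (\<forall>v. Ck_on k D (\<lambda>x. frechet_derivative f (at x) v))"

definition smooth_on :: "'a::real_normed_vector set \<Rightarrow> ('a \<Rightarrow> real) \<Rightarrow> bool" where
  "smooth_on D f \<longleftrightarrow> (\<forall>k. Ck_on k D f)"


section \<open>Pseudoconvex domains\<close>

text \<open>
  A real-valued continuous function is plurisubharmonic iff on every closed complex disc
  \<open>{z + \<zeta>w : |\<zeta>| \<le> 1}\<close> contained in \<open>D\<close> its value at the centre is at most its mean over the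
  boundary circle.  The radius of the disc is absorbed into \<open>w\<close>.
\<close>

definition continuous_psh_on :: "(complex^'n) set \<Rightarrow> (complex^'n \<Rightarrow> real) \<Rightarrow> bool" where
  "continuous_psh_on D u \<longleftrightarrow> continuous_on D u \<and>
     (\<forall>z w. {z + \<zeta> *s w | \<zeta>. cmod \<zeta> \<le> 1} \<subseteq> D \<longrightarrow>
        u z \<le> integral {0..2*pi} (\<lambda>t. u (z + cis t *s w)) / (2*pi))"

text \<open>
  Pseudoconvexity in the sense of Hoermander: there is a continuous plurisubharmonic function
  whose sublevel sets are relatively compact in \<open>D\<close>.  (Allowing the value \<open>-\<infinity>\<close> would give
  nothing new, as \<open>u\<close> can be replaced by \<open>max u 0\<close>.)
\<close>

definition pseudoconvex :: "(complex^'n) set \<Rightarrow> bool" where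
  "pseudoconvex D \<longleftrightarrow> open D \<and>
     (\<exists>u. continuous_psh_on D u \<and>
        (\<forall>r. compact (closure {z\<in>D. u z < r}) \<and> closure {z\<in>D. u z < r} \<subseteq> D))"

definition pseudoconvex_domain :: "(complex^'n) set \<Rightarrow> bool" where
  "pseudoconvex_domain D \<longleftrightarrow> D \<noteq> {} \<and> connected D \<and> pseudoconvex D"


section \<open>The complex Hessian and its eigenvalues\<close>

text \<open>
  Wirtinger derivatives: \<open>\<partial>/\<partial>z\<^sub>j = (\<partial>/\<partial>x\<^sub>j - \<i> \<partial>/\<partial>y\<^sub>j)/2\<close> and
  its conjugate operator \<open>(\<partial>/\<partial>x\<^sub>j + \<i> \<partial>/\<partial>y\<^sub>j)/2\<close>, where \<open>x\<^sub>j\<close> and \<open>y\<^sub>j\<close> are the directions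
  \<open>axis j 1\<close> and \<open>axis j \<i>\<close>.
\<close>

definition dz :: "'n \<Rightarrow> (complex^'n \<Rightarrow> complex) \<Rightarrow> complex^'n \<Rightarrow> complex" where
  "dz j f z = (frechet_derivative f (at z) (axis j 1)
             - \<i> * frechet_derivative f (at z) (axis j \<i>)) / 2"

definition dzbar :: "'n \<Rightarrow> (complex^'n \<Rightarrow> complex) \<Rightarrow> complex^'n \<Rightarrow> complex" where
  "dzbar j f z = (frechet_derivative f (at z) (axis j 1)
                + \<i> * frechet_derivative f (at z) (axis j \<i>)) / 2"

definition complex_hessian :: "(complex^'n \<Rightarrow> real) \<Rightarrow> complex^'n \<Rightarrow> complex^'n^'n" where
  "complex_hessian \<phi> z = (\<chi> j k. dz j (dzbar k (\<lambda>x. of_real (\<phi> x))) z)"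

definition charpoly :: "'a::comm_ring_1^'n^'n \<Rightarrow> 'a poly" where
  "charpoly A = det (\<chi> i j. (if i = j then [:0, 1:] else 0) - [:A $ i $ j:])"

text \<open>
  The eigenvalues of \<open>\<i> ddbar \<phi>\<close> with respect to \<open>\<omega> = \<i> ddbar |z|\<^sup>2\<close> (whose matrix is the identity)
  at \<open>z\<close>, as the multiset of roots of the characteristic polynomial.  For smooth real \<open>\<phi>\<close> the
  matrix is Hermitian, so all roots are real and \<open>Re\<close> only changes the type.
\<close>

definition ddbar_eigenvalues :: "(complex^'n \<Rightarrow> real) \<Rightarrow> complex^'n \<Rightarrow> real multiset" where
  "ddbar_eigenvalues \<phi> z = image_mset Re (proots (charpoly (complex_hessian \<phi> z)))"

text \<open>
  Choosing indices \<open>i\<^sub>1 < \<dots> < i\<^sub>q\<close> in the list of eigenvalues amounts to choosing a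
  submultiset of size \<open>q\<close>.
\<close>

definition q_sums_ge :: "nat \<Rightarrow> real \<Rightarrow> (complex^'n) set \<Rightarrow> (complex^'n \<Rightarrow> real) \<Rightarrow> bool" where
  "q_sums_ge q c D \<phi> \<longleftrightarrow>
     (\<forall>z\<in>D. \<forall>S. S \<subseteq># ddbar_eigenvalues \<phi> z \<and> size S = q \<longrightarrow> \<Sum>\<^sub># S \<ge> c)"

end

theory Submission
  imports Defs
begin

text \<open>
  The eigenvalue condition is about numbers attached nonlinearly to \<open>\<phi>\<close>, and pointwise convergence gives
  no control of derivatives, so the condition is first made linear and then carried to the limit by the
  maximum principle.

  By Ky Fan's minimum principle the smallest sum of \<open>q\<close> eigenvalues of a Hermitian matrix \<open>H\<close> is the
  minimum of \<open>H(v\<^sub>1, v\<^sub>1) + \<dots> + H(v\<^sub>q, v\<^sub>q)\<close> over Hermitian orthonormal families.  So the condition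
  \<open>q_sums_ge\<close> says that along every complex \<open>q\<close>-plane a quarter of the Laplacian, which is a sum of
  values of the Levi form \<open>levi f z v = (D\<^sup>2f(v, v) + D\<^sup>2f(\<i>v, \<i>v)) / 4\<close>, is at least \<open>c\<close>
  (\<open>ky_fan_lower_bound\<close>, \<open>q_sums_ge_iff_levi\<close>).  The translation needs the spectral theorem, proved
  here by maximizing Rayleigh quotients, and the symmetry of second derivatives, which makes the
  complex Hessian Hermitian.

  Now suppose that for some orthonormal \<open>v\<^sub>1, \<dots>, v\<^sub>q\<close> the sum for \<open>\<phi>\<close> is less than \<open>c\<close> at \<open>z\<close>.  By
  continuity it is less than \<open>c - q\<kappa>\<close> on a small closed ball about \<open>z\<close>, for some \<open>\<kappa> > 0\<close>.  The function
  \<open>\<psi>\<^sub>j - \<phi> - \<kappa>|x - z|\<^sup>2\<close> is nonnegative at \<open>z\<close> because \<open>\<psi>\<^sub>j\<close> decreases to \<open>\<phi>\<close>, and for large \<open>j\<close> it is negative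
  on the sphere because the convergence is uniform there, as in Dini's theorem
  (\<open>decreasing_limit_interior_max\<close>).  So it has an interior maximum \<open>p\<close>, where second
  derivatives are nonpositive and therefore \<open>levi \<psi>\<^sub>j p v\<^sub>a \<le> levi \<phi> p v\<^sub>a + \<kappa>\<close>
  (\<open>levi_le_at_max_of_difference\<close>).  Summing over \<open>a\<close> shows that the sum for \<open>\<psi>\<^sub>j\<close> at \<open>p\<close> is less than \<open>c\<close>,
  a contradiction.
\<close>

section \<open>Unitary diagonalization of Hermitian matrices\<close>

text \<open>
  A maximizer of the Rayleigh quotient on the unit sphere of \<open>W\<close> is an eigenvector: the residual
  \<open>w = f e - \<mu> e\<close> lies in \<open>W\<close> by invariance, and moving from \<open>e\<close> in its direction would increase the
  quotient to first order unless \<open>w = 0\<close>.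
\<close>

lemma symmetric_operator_has_eigenvector:
  fixes f :: "'a::euclidean_space \<Rightarrow> 'a"
  assumes "linear f" and sym: "\<And>x y. f x \<bullet> y = x \<bullet> f y"
    and W: "subspace W" "W \<noteq> {0}" "f ` W \<subseteq> W"
  obtains e \<mu> where "e \<in> W" "norm e = 1" "f e = \<mu> *\<^sub>R e"
proof -
  interpret f: linear f by fact
  let ?S = "sphere 0 1 \<inter> W"
  have "compact ?S"
    by (intro compact_Int_closed compact_sphere closed_subspace W)
  moreover have "?S \<noteq> {}"
  proof -
    obtain w where "w \<in> W" "w \<noteq> 0" using W subspace_0 by blast
    then have "(1 / norm w) *\<^sub>R w \<in> ?S" using W by (auto simp: subspace_scale)
    then show ?thesis by blast
  qed
  moreover have "continuous_on ?S (\<lambda>x. x \<bullet> f x)"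
    by (intro continuous_intros linear_continuous_on_compose[OF _ \<open>linear f\<close>])
  ultimately obtain e where e: "e \<in> ?S" and max: "\<And>x. x \<in> ?S \<Longrightarrow> x \<bullet> f x \<le> e \<bullet> f e"
    using continuous_attains_sup by metis
  define \<mu> where "\<mu> = e \<bullet> f e"
  have bound: "x \<bullet> f x \<le> \<mu> * (norm x)\<^sup>2" if "x \<in> W" for x
  proof (cases "x = 0")
    case False
    have "(1 / norm x) *\<^sub>R x \<in> ?S" using W that False by (auto simp: subspace_scale)
    from max[OF this] have "x \<bullet> f x / (norm x)\<^sup>2 \<le> \<mu>"
      by (simp add: f.scale \<mu>_def power2_eq_square)
    then show ?thesis using False by (simp add: divide_simps)
  qed (simp add: f.zero)
  define w where "w = f e - \<mu> *\<^sub>R e"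
  have wW: "w \<in> W" unfolding w_def using e W by (auto intro!: subspace_diff subspace_scale)
  have ee: "e \<bullet> e = 1" using e by (simp add: norm_eq_1)
  \<comment> \<open>First variation of the Rayleigh quotient in the direction of the residual.\<close>
  have quad: "2 * t * (w \<bullet> w) + t\<^sup>2 * (w \<bullet> f w - \<mu> * (w \<bullet> w)) \<le> 0" for t
  proof -
    have "e + t *\<^sub>R w \<in> W" using e wW W by (auto intro!: subspace_add subspace_scale)
    from bound[OF this]
    have "e \<bullet> f e + 2 * t * (w \<bullet> f e) + t\<^sup>2 * (w \<bullet> f w)
        \<le> \<mu> * (e \<bullet> e + 2 * t * (w \<bullet> e) + t\<^sup>2 * (w \<bullet> w))"
      using sym[of e w] unfolding power2_norm_eq_inner
      by (simp add: f.add f.scale inner_add_left inner_add_right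
          algebra_simps power2_eq_square inner_commute)
    moreover have "w \<bullet> f e = w \<bullet> w + \<mu> * (w \<bullet> e)"
      by (simp add: w_def algebra_simps)
    ultimately show ?thesis using ee by (simp add: \<mu>_def[symmetric] algebra_simps)
  qed
  have "w \<bullet> w = 0"
  proof (rule ccontr)
    assume nz: "w \<bullet> w \<noteq> 0"
    \<comment> \<open>A step so short that the linear term exceeds the quadratic one.\<close>
    define b where "b = \<bar>w \<bullet> f w - \<mu> * (w \<bullet> w)\<bar> + 1"
    define t where "t = (w \<bullet> w) / b"
    have b: "b > 0" "- b \<le> w \<bullet> f w - \<mu> * (w \<bullet> w)" by (auto simp: b_def)
    have p: "w \<bullet> w > 0" using nz inner_ge_zero[of w] by linarith
    have t: "t > 0" using b p by (simp add: t_def)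
    have "2 * t * (w \<bullet> w) + t\<^sup>2 * (- b) \<le> 0"
      using quad[of t] mult_left_mono[OF b(2), of "t\<^sup>2"] by (simp; linarith)
    moreover have "t\<^sup>2 * b = t * (w \<bullet> w)" using b by (simp add: t_def power2_eq_square)
    ultimately have "t * (w \<bullet> w) \<le> 0" by simp
    then show False using t p by (simp add: mult_le_0_iff)
  qed
  then have "f e = \<mu> *\<^sub>R e" by (simp add: w_def)
  then show ?thesis using that e by auto
qed

definition herm :: "complex^'n \<Rightarrow> complex^'n \<Rightarrow> complex" where
  "herm x y = (\<Sum>i\<in>UNIV. x $ i * cnj (y $ i))"

text \<open>
  The index set is a parameter so that the same notion covers bases, indexed by the whole type, and
  families of \<open>q\<close> vectors, indexed by a set with \<open>q\<close> elements.
\<close>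

definition unitary_on :: "'b set \<Rightarrow> ('b \<Rightarrow> complex^'n) \<Rightarrow> bool" where
  "unitary_on I v \<longleftrightarrow> (\<forall>a\<in>I. \<forall>b\<in>I. herm (v a) (v b) = (if a = b then 1 else 0))"

definition hermitian :: "complex^'n^'n \<Rightarrow> bool" where
  "hermitian A \<longleftrightarrow> (\<forall>j k. A $ k $ j = cnj (A $ j $ k))"

lemma herm_algebra:
  "herm (x + y) z = herm x z + herm y z" "herm x (y + z) = herm x y + herm x z"
  "herm (x - y) z = herm x z - herm y z" "herm x (y - z) = herm x y - herm x z"
  "herm (c *s x) y = c * herm x y" "herm x (c *s y) = cnj c * herm x y"
  "herm 0 y = 0" "herm x 0 = 0"
  by (auto simp: herm_def algebra_simps sum.distrib sum_subtractf sum_distrib_left)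

lemma herm_sum_left: "herm (\<Sum>a\<in>I. f a) y = (\<Sum>a\<in>I. herm (f a) y)"
  by (induction I rule: infinite_finite_induct) (auto simp: herm_algebra)

lemma herm_sum_right: "herm y (\<Sum>a\<in>I. f a) = (\<Sum>a\<in>I. herm y (f a))"
  by (induction I rule: infinite_finite_induct) (auto simp: herm_algebra)

lemma cnj_herm: "cnj (herm x y) = herm y x"
  by (simp add: herm_def mult.commute)

lemma Re_herm: "Re (herm x y) = x \<bullet> y"
  by (simp add: herm_def inner_vec_def inner_complex_def)

lemma Im_herm: "Im (herm x y) = x \<bullet> (\<i> *s y)"
  using Re_herm[of x "\<i> *s y"] by (simp add: herm_algebra)

lemma herm_self: "herm x x = of_real ((norm x)\<^sup>2)"
proof (rule complex_eqI)
  show "Im (herm x x) = Im (of_real ((norm x)\<^sup>2))"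
    using cnj_herm[of x x] by (simp add: complex_eq_iff)
qed (simp add: Re_herm power2_norm_eq_inner)

lemma herm_matrix_adjoint:
  assumes "hermitian A"
  shows "herm (A *v x) y = herm x (A *v y)"
proof -
  have "herm (A *v x) y = (\<Sum>i\<in>UNIV. \<Sum>j\<in>UNIV. A $ i $ j * x $ j * cnj (y $ i))"
    by (simp add: herm_def matrix_vector_mult_def sum_distrib_right)
  also have "\<dots> = (\<Sum>j\<in>UNIV. \<Sum>i\<in>UNIV. A $ i $ j * x $ j * cnj (y $ i))"
    by (rule sum.swap)
  also have "\<dots> = herm x (A *v y)"
    unfolding herm_def matrix_vector_mult_def vec_lambda_beta cnj_sum complex_cnj_mult sum_distrib_left
  proof (intro sum.cong refl)
    fix i j
    have "A $ i $ j = cnj (A $ j $ i)" using assms unfolding hermitian_def by blast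
    then show "A $ i $ j * x $ j * cnj (y $ i) = x $ j * (cnj (A $ j $ i) * cnj (y $ i))" by simp
  qed
  finally show ?thesis .
qed

text \<open>
  The Hermitian orthogonal complement of a family of eigenvectors is invariant under \<open>A\<close>.  As a real
  subspace it is nonzero, since it is cut out by fewer real conditions than the real dimension, and
  \<open>A\<close> acts on it symmetrically for the real inner product, the real part of \<open>herm\<close>.  So the real
  eigenvector lemma applies to it.
\<close>

lemma unitary_family_extends_by_eigenvector:
  fixes A :: "complex^'n^'n"
  assumes A: "hermitian A" and J: "card J < CARD('n)"
    and eig: "\<And>i. i \<in> J \<Longrightarrow> A *v e i = complex_of_real (\<gamma> i) *s e i"
  obtains x \<mu> where "herm x x = 1" "A *v x = complex_of_real \<mu> *s x" "\<And>i. i \<in> (J::'n set) \<Longrightarrow> herm x (e i) = 0"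
proof -
  define W where "W = {x. \<forall>i\<in>J. herm x (e i) = 0}"
  have scaleR: "r *\<^sub>R x = complex_of_real r *s x" for r and x :: "complex^'n"
    by (simp add: vec_eq_iff scaleR_conv_of_real[where 'a=complex])
  have "linear ((*v) A)"
    by (intro linearI) (simp_all add: matrix_vector_right_distrib scaleR vector_scalar_commute)
  moreover have "(A *v x) \<bullet> y = x \<bullet> (A *v y)" for x y
    using herm_matrix_adjoint[OF A, of x y] by (metis Re_herm)
  moreover have "subspace W"
    unfolding subspace_def W_def by (auto simp: herm_algebra scaleR)
  moreover have "W \<noteq> {0}"
  proof -
    \<comment> \<open>Complex orthogonality to \<open>e i\<close> is real orthogonality to both \<open>e i\<close> and \<open>\<i> e i\<close>.\<close>
    let ?S = "e ` J \<union> (\<lambda>i. \<i> *s e i) ` J"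
    have "dim ?S \<le> card ?S" by (rule dim_le_card') simp
    also have "\<dots> \<le> card (e ` J) + card ((\<lambda>i. \<i> *s e i) ` J)" by (rule card_Un_le)
    also have "\<dots> \<le> card J + card J" by (intro add_mono card_image_le) simp_all
    also have "\<dots> < DIM(complex^'n)" using J by simp
    finally obtain x where x: "x \<noteq> 0" "\<And>y. y \<in> span ?S \<Longrightarrow> orthogonal x y"
      by (rule orthogonal_to_subspace_exists) blast
    have "herm x (e i) = 0" if "i \<in> J" for i
      using x(2)[of "e i"] x(2)[of "\<i> *s e i"] that
      by (auto simp: complex_eq_iff Re_herm Im_herm orthogonal_def span_base)
    then show ?thesis using x(1) by (auto simp: W_def)
  qed
  moreover have "(*v) A ` W \<subseteq> W"
    by (auto simp: W_def herm_matrix_adjoint[OF A] eig herm_algebra)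
  ultimately obtain x \<mu> where "x \<in> W" "norm x = 1" "A *v x = \<mu> *\<^sub>R x"
    by (rule symmetric_operator_has_eigenvector)
  then show ?thesis by (intro that[of x \<mu>]) (simp_all add: herm_self W_def scaleR)
qed

theorem hermitian_unitary_eigenbasis:
  fixes A :: "complex^'n^'n"
  assumes A: "hermitian A"
  obtains e :: "'n \<Rightarrow> complex^'n" and \<gamma> :: "'n \<Rightarrow> real"
  where "unitary_on UNIV e" "\<And>i. A *v e i = complex_of_real (\<gamma> i) *s e i"
proof -
  have "\<exists>e \<gamma>. unitary_on J e \<and> (\<forall>i\<in>J. A *v e i = complex_of_real (\<gamma> i) *s e i)" for J :: "'n set"
  proof (induction J rule: finite_induct[OF finite])
    case 1
    show ?case by (simp add: unitary_on_def)
  next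
    case (2 k J)
    then obtain e \<gamma> where e: "unitary_on J e" "\<And>i. i \<in> J \<Longrightarrow> A *v e i = complex_of_real (\<gamma> i) *s e i"
      by blast
    have "card J < CARD('n)" using \<open>k \<notin> J\<close> by (intro psubset_card_mono) auto
    with e(2) obtain x \<mu> where x: "herm x x = 1" "A *v x = complex_of_real \<mu> *s x" "\<And>i. i \<in> J \<Longrightarrow> herm x (e i) = 0"
      using unitary_family_extends_by_eigenvector[OF A] by metis
    have "herm (e i) x = 0" if "i \<in> J" for i using x(3)[OF that] cnj_herm[of x "e i"] by simp
    then have "unitary_on (insert k J) (e(k := x))"
      using e(1) x \<open>k \<notin> J\<close> by (auto simp: unitary_on_def)
    moreover have "\<forall>i\<in>insert k J. A *v (e(k := x)) i = complex_of_real ((\<gamma>(k := \<mu>)) i) *s (e(k := x)) i"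
      using e(2) x(2) \<open>k \<notin> J\<close> by auto
    ultimately show ?case by blast
  qed
  from this[of UNIV] obtain e :: "'n \<Rightarrow> complex^'n" and \<gamma> where "unitary_on UNIV e"
    "\<forall>i. A *v e i = complex_of_real (\<gamma> i) *s e i" by auto
  then show ?thesis using that[of e \<gamma>] by simp
qed

text \<open>
  For square matrices a left inverse is a right inverse: orthonormality of the columns gives the
  completeness relation behind Parseval's identity.
\<close>

lemma unitary_basis_matrix:
  fixes e :: "'n \<Rightarrow> complex^'n"
  assumes "unitary_on UNIV e"
  shows "(\<chi> i j. cnj (e i $ j)) ** (\<chi> i j. e j $ i) = mat 1"
    and "(\<chi> i j. e j $ i) ** (\<chi> i j. cnj (e i $ j)) = mat 1"
proof -
  show *: "(\<chi> i j. cnj (e i $ j)) ** (\<chi> i j. e j $ i) = mat 1"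
    using assms by (simp add: vec_eq_iff matrix_matrix_mult_def mat_def unitary_on_def herm_def mult.commute)
  then show "(\<chi> i j. e j $ i) ** (\<chi> i j. cnj (e i $ j)) = mat 1"
    by (simp add: matrix_left_right_inverse)
qed

lemma herm_parseval:
  fixes e :: "'n \<Rightarrow> complex^'n"
  assumes "unitary_on UNIV e"
  shows "herm v w = (\<Sum>i\<in>UNIV. herm v (e i) * cnj (herm w (e i)))"
proof -
  have "(\<Sum>i\<in>UNIV. e i $ k * cnj (e i $ j)) = (if k = j then 1 else 0)" for j k
    using unitary_basis_matrix(2)[OF assms] by (simp add: vec_eq_iff matrix_matrix_mult_def mat_def)
  then have complete: "(\<Sum>i\<in>UNIV. cnj (e i $ j) * e i $ k) = (if j = k then 1 else 0)" for j k
    by (simp add: mult.commute eq_commute[of j k])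
  have "(\<Sum>i\<in>UNIV. herm v (e i) * cnj (herm w (e i)))
      = (\<Sum>i\<in>UNIV. \<Sum>j\<in>UNIV. \<Sum>k\<in>UNIV. v $ j * cnj (w $ k) * (cnj (e i $ j) * e i $ k))"
    by (simp add: herm_def sum_product ac_simps)
  also have "\<dots> = (\<Sum>j\<in>UNIV. \<Sum>i\<in>UNIV. \<Sum>k\<in>UNIV. v $ j * cnj (w $ k) * (cnj (e i $ j) * e i $ k))"
    by (rule sum.swap)
  also have "\<dots> = (\<Sum>j\<in>UNIV. \<Sum>k\<in>UNIV. \<Sum>i\<in>UNIV. v $ j * cnj (w $ k) * (cnj (e i $ j) * e i $ k))"
    by (intro sum.cong refl sum.swap)
  also have "\<dots> = (\<Sum>j\<in>UNIV. \<Sum>k\<in>UNIV. v $ j * cnj (w $ k) * (if j = k then 1 else 0))"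
    by (simp only: complete flip: sum_distrib_left)
  also have "\<dots> = herm v w" by (simp add: herm_def if_distrib[where f="\<lambda>x. _ * x"] cong: if_cong)
  finally show ?thesis by simp
qed

text \<open>
  If \<open>y\<close> is the orthogonal projection of \<open>x\<close>, then the sum \<open>s\<close> on the left is the common value of
  \<open>herm x y\<close> and \<open>herm y y\<close>, so \<open>norm (x - y)\<close> has square \<open>(norm x)\<^sup>2 - s\<close>.
\<close>

lemma herm_bessel:
  assumes "finite I" and v: "unitary_on I v"
  shows "(\<Sum>a\<in>I. (cmod (herm (v a) x))\<^sup>2) \<le> (norm x)\<^sup>2"
proof -
  define y where "y = (\<Sum>a\<in>I. herm x (v a) *s v a)"
  define s where "s = (\<Sum>a\<in>I. (cmod (herm (v a) x))\<^sup>2)"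
  have yv: "herm y (v a) = herm x (v a)" if "a \<in> I" for a
  proof -
    have "herm y (v a) = (\<Sum>b\<in>I. if b = a then herm x (v b) else 0)"
      unfolding y_def herm_sum_left using v that
      by (intro sum.cong) (auto simp: herm_algebra unitary_on_def)
    then show ?thesis using that assms(1) by simp
  qed
  have modsq: "cnj (herm x (v a)) * herm x (v a) = of_real ((cmod (herm (v a) x))\<^sup>2)" for a
    by (metis cnj_herm complex_norm_square mult.commute)
  have xy: "herm x y = of_real s"
    by (simp add: y_def s_def herm_sum_right herm_algebra modsq)
  have yy: "herm y y = of_real s"
    by (subst (2) y_def) (simp add: s_def herm_sum_right herm_algebra yv modsq)
  have "herm y x = of_real s" using xy cnj_herm[of x y] by simp
  then have "herm (x - y) (x - y) = of_real ((norm x)\<^sup>2 - s)"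
    using xy yy by (simp add: herm_algebra herm_self[of x])
  then have "(norm (x - y))\<^sup>2 = (norm x)\<^sup>2 - s" by (metis herm_self of_real_eq_iff)
  then show ?thesis unfolding s_def[symmetric] using zero_le_power2[of "norm (x - y)"] by linarith
qed

text \<open>
  An eigenbasis intertwines \<open>X \<cdot> 1 - A\<close> with a diagonal matrix over the polynomial ring; the base
  change matrix has invertible determinant, so the two determinants agree.
\<close>

lemma proots_charpoly_diagonalized:
  fixes A :: "complex^'n^'n" and e :: "'n \<Rightarrow> complex^'n"
  assumes e: "unitary_on UNIV e" and eig: "\<And>i. A *v e i = complex_of_real (\<gamma> i) *s e i"
  shows "proots (charpoly A) = image_mset (\<lambda>i. complex_of_real (\<gamma> i)) (mset_set UNIV)"
proof -
  define U :: "complex poly^'n^'n" where "U = (\<chi> i j. [:e j $ i:])"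
  define V :: "complex poly^'n^'n" where "V = (\<chi> i j. [:cnj (e i $ j):])"
  define M :: "complex poly^'n^'n" where
    "M = (\<chi> i j. (if i = j then [:0, 1:] else 0) - [:A $ i $ j:])"
  define L :: "complex poly^'n^'n" where
    "L = (\<chi> i j. if i = j then [:- complex_of_real (\<gamma> i), 1:] else 0)"
  have const_sum: "(\<Sum>k\<in>S. [:f k:]) = [:\<Sum>k\<in>S. f k:]" for f :: "'n \<Rightarrow> complex" and S
    by (induction S rule: infinite_finite_induct) auto
  have VU: "V ** U = mat 1"
    using unitary_basis_matrix(1)[OF e]
    by (simp add: vec_eq_iff matrix_matrix_mult_def mat_def U_def V_def const_sum one_pCons mult.commute)
  have MU: "M ** U = U ** L"
  proof -
    have "(\<Sum>k\<in>UNIV. A $ i $ k * e j $ k) = complex_of_real (\<gamma> j) * e j $ i" for i j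
      using eig[of j] by (simp add: vec_eq_iff matrix_vector_mult_def)
    then show ?thesis
      by (simp add: vec_eq_iff matrix_matrix_mult_def M_def U_def L_def smult_diff_right sum_subtractf
          const_sum if_distrib[where f="smult _"] if_distrib[where f="\<lambda>x. _ * x"] mult.commute cong: if_cong)
  qed
  have "det V * det U = 1" using VU by (metis det_I det_mul)
  then have "det U \<noteq> 0" by auto
  moreover have "det M * det U = det L * det U" using MU by (metis det_mul mult.commute)
  ultimately have "charpoly A = det L" by (simp add: charpoly_def M_def)
  also have "\<dots> = (\<Prod>i\<in>UNIV. [:- complex_of_real (\<gamma> i), 1:])"
    by (subst det_diagonal) (auto simp: L_def)
  finally have "proots (charpoly A) = (\<Sum>i\<in>UNIV. {#complex_of_real (\<gamma> i)#})"
    by (simp add: proots_prod)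
  also have "\<dots> = image_mset (\<lambda>i. complex_of_real (\<gamma> i)) (mset_set UNIV)"
    by (simp add: sum_unfold_sum_mset)
  finally show ?thesis .
qed

section \<open>Ky Fan's minimum principle\<close>

lemma submultiset_of_image:
  assumes "finite X" "S \<subseteq># image_mset f (mset_set X)"
  obtains I where "I \<subseteq> X" "S = image_mset f (mset_set I)"
proof -
  obtain T where "image_mset f (mset_set X) = S + T"
    using assms(2) by (metis subset_mset.le_iff_add)
  then obtain M N where MN: "mset_set X = M + N" "S = image_mset f M"
    by (metis image_mset_eq_plusD)
  have "M \<subseteq># mset_set X" using MN by simp
  then have "M = mset_set (set_mset M)"
  proof (intro multiset_eqI)
    fix x
    have "count M x \<le> 1"
      using mset_subset_eq_count[OF \<open>M \<subseteq># mset_set X\<close>, of x] by (simp add: count_mset_set' split: if_splits)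
    then show "count M x = count (mset_set (set_mset M)) x"
      by (cases "x \<in># M") (auto simp: le_Suc_eq count_eq_zero_iff)
  qed
  moreover have "set_mset M \<subseteq> X" using \<open>M \<subseteq># mset_set X\<close> assms(1)
    by (metis finite_set_mset_mset_set set_mset_mono)
  ultimately show ?thesis using that MN(2) by metis
qed

text \<open>
  Weights between \<open>0\<close> and \<open>1\<close> with total mass \<open>q\<close> give a weighted sum minimized by putting all the mass on
  \<open>q\<close> smallest values.  For a minimizing set \<open>I\<close>, exchanging elements shows that some threshold \<open>m\<close>
  separates the values on \<open>I\<close> from the others; the mass missing on \<open>I\<close> sits outside, where it costs at
  least \<open>m\<close> per unit instead of at most \<open>m\<close>.
\<close>

lemma weighted_sum_ge_smallest_sum:
  fixes \<gamma> p :: "'a \<Rightarrow> real"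
  assumes "finite X" and "q \<le> card X" and p: "\<And>i. i \<in> X \<Longrightarrow> 0 \<le> p i \<and> p i \<le> 1"
    and total: "sum p X = real q"
    and sums: "\<And>I. I \<subseteq> X \<Longrightarrow> card I = q \<Longrightarrow> c \<le> sum \<gamma> I"
  shows "c \<le> (\<Sum>i\<in>X. \<gamma> i * p i)"
proof -
  let ?F = "{I. I \<subseteq> X \<and> card I = q}"
  have "finite ?F" using assms(1) by simp
  moreover have "?F \<noteq> {}" using assms(2) obtain_subset_with_card_n by blast
  ultimately obtain I where I: "I \<in> ?F" and least: "\<And>J. J \<in> ?F \<Longrightarrow> sum \<gamma> I \<le> sum \<gamma> J"
    using ex_min_if_finite[of "sum \<gamma> ` ?F"] by (auto simp: not_less)
  have fI: "finite I" and IX: "I \<subseteq> X" using I assms(1) finite_subset by auto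
  have swap: "\<gamma> i \<le> \<gamma> j" if "i \<in> I" "j \<in> X - I" for i j
  proof -
    have "insert j (I - {i}) \<in> ?F"
      using I that fI by (auto simp: card_insert_if card_Suc_Diff1 simp del: card_Diff_insert)
    from least[OF this] show ?thesis
      using that fI by (simp add: sum_diff1)
  qed
  obtain m where m: "\<And>i. i \<in> I \<Longrightarrow> \<gamma> i \<le> m" "\<And>j. j \<in> X - I \<Longrightarrow> m \<le> \<gamma> j"
  proof (cases "I = {}")
    case True
    \<comment> \<open>Only a lower bound is needed; inserting \<open>0\<close> keeps the minimum meaningful for empty \<open>X\<close>.\<close>
    show ?thesis
    proof (rule that[of "Min (insert 0 (\<gamma> ` X))"])
    qed (use True assms(1) in auto)
  next
    case False
    show ?thesis
    proof (rule that[of "Max (\<gamma> ` I)"])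
      fix j assume "j \<in> X - I"
      then show "Max (\<gamma> ` I) \<le> \<gamma> j" using swap fI False by auto
    qed (use fI in auto)
  qed
  have split: "sum g X = sum g I + sum g (X - I)" for g :: "'a \<Rightarrow> real"
    using sum.subset_diff[OF IX assms(1), of g] by simp
  have "m * (real q - sum p I) = (\<Sum>j\<in>X - I. m * p j)"
    using total split[of p] by (simp flip: sum_distrib_left)
  also have "\<dots> \<le> (\<Sum>j\<in>X - I. \<gamma> j * p j)"
    using m(2) p by (intro sum_mono mult_right_mono) auto
  finally have 1: "m * (real q - sum p I) \<le> (\<Sum>j\<in>X - I. \<gamma> j * p j)" .
  have "sum \<gamma> I - (\<Sum>i\<in>I. \<gamma> i * p i) = (\<Sum>i\<in>I. \<gamma> i * (1 - p i))"
    by (simp add: algebra_simps sum_subtractf)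
  also have "\<dots> \<le> (\<Sum>i\<in>I. m * (1 - p i))"
    using m(1) p IX by (intro sum_mono mult_right_mono) auto
  also have "\<dots> = m * (real q - sum p I)"
    using I by (simp add: sum_subtractf flip: sum_distrib_left)
  finally have 2: "sum \<gamma> I - (\<Sum>i\<in>I. \<gamma> i * p i) \<le> m * (real q - sum p I)" .
  have "c \<le> sum \<gamma> I" using sums I by auto
  then show ?thesis using 1 2 split[of "\<lambda>i. \<gamma> i * p i"] by linarith
qed

text \<open>
  In an eigenbasis \<open>e\<close> the sum over a unitary family \<open>v\<close> becomes \<open>\<Sum>i. \<gamma> i * p i\<close>, where \<open>p i\<close> is the total
  squared modulus of the coefficients of the \<open>v a\<close> along \<open>e i\<close>.  Bessel's inequality gives \<open>p i \<le> 1\<close>, and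
  Parseval's identity gives total mass \<open>q\<close>, so the weights are admissible in the previous lemma.
  Conversely, a choice of \<open>q\<close> eigenvalues is the sum over the corresponding eigenvectors.
\<close>

theorem ky_fan_lower_bound:
  fixes A :: "complex^'n^'n"
  assumes A: "hermitian A"
  shows "(\<forall>S. S \<subseteq># image_mset Re (proots (charpoly A)) \<and> size S = q \<longrightarrow> c \<le> \<Sum>\<^sub># S) \<longleftrightarrow>
    (\<forall>(I :: 'n set) v. card I = q \<and> unitary_on I v \<longrightarrow> c \<le> (\<Sum>a\<in>I. Re (herm (A *v v a) (v a))))"
    (is "?L \<longleftrightarrow> ?R")
proof -
  obtain e :: "'n \<Rightarrow> complex^'n" and \<gamma> where e: "unitary_on UNIV e"
    and eig: "\<And>i. A *v e i = complex_of_real (\<gamma> i) *s e i"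
    using hermitian_unitary_eigenbasis[OF A] by metis
  have ev: "image_mset Re (proots (charpoly A)) = image_mset \<gamma> (mset_set UNIV)"
    by (simp add: proots_charpoly_diagonalized[OF e eig] multiset.map_comp o_def)
  show ?thesis
  proof
    assume L: ?L
    have sums: "c \<le> sum \<gamma> I" if "card I = q" for I
    proof -
      have "image_mset \<gamma> (mset_set I) \<subseteq># image_mset \<gamma> (mset_set UNIV)"
        by (intro image_mset_subseteq_mono) simp
      then show ?thesis using L that unfolding ev by (simp add: sum_unfold_sum_mset)
    qed
    show ?R
    proof (intro allI impI)
      fix I :: "'n set" and v :: "'n \<Rightarrow> complex^'n"
      assume "card I = q \<and> unitary_on I v"
      then have I: "card I = q" and v: "unitary_on I v" by auto
      define p where "p i = (\<Sum>a\<in>I. (cmod (herm (v a) (e i)))\<^sup>2)" for i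
      have modsq: "z * cnj z = of_real ((cmod z)\<^sup>2)" for z by (rule complex_norm_square[symmetric])
      have p1: "p i \<le> 1" for i
      proof -
        have "(norm (e i))\<^sup>2 = 1"
          using e herm_self[of "e i"] by (simp add: unitary_on_def flip: of_real_power)
        then show ?thesis using herm_bessel[OF _ v, of "e i"] by (simp add: p_def)
      qed
      have "sum p UNIV = (\<Sum>a\<in>I. \<Sum>i\<in>UNIV. (cmod (herm (v a) (e i)))\<^sup>2)"
        unfolding p_def by (rule sum.swap)
      also have "\<dots> = (\<Sum>a\<in>I. 1)"
      proof (intro sum.cong refl)
        fix a assume "a \<in> I"
        then have "herm (v a) (v a) = 1" using v by (simp add: unitary_on_def)
        then have "complex_of_real (\<Sum>i\<in>UNIV. (cmod (herm (v a) (e i)))\<^sup>2) = of_real 1"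
          by (subst (asm) herm_parseval[OF e]) (simp add: modsq del: of_real_power)
        then show "(\<Sum>i\<in>UNIV. (cmod (herm (v a) (e i)))\<^sup>2) = 1" by (simp only: of_real_eq_iff)
      qed
      finally have total: "sum p UNIV = real q" using I by simp
      have "c \<le> (\<Sum>i\<in>UNIV. \<gamma> i * p i)"
        using p1 total sums I card_mono[of UNIV I]
        by (intro weighted_sum_ge_smallest_sum[of UNIV q]) (auto simp: p_def intro!: sum_nonneg)
      also have "\<dots> = (\<Sum>a\<in>I. \<Sum>i\<in>UNIV. \<gamma> i * (cmod (herm (v a) (e i)))\<^sup>2)"
        unfolding p_def sum_distrib_left by (rule sum.swap)
      also have "\<dots> = (\<Sum>a\<in>I. Re (herm (A *v v a) (v a)))"
      proof (intro sum.cong refl)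
        fix a
        have "herm (A *v v a) (v a) = of_real (\<Sum>i\<in>UNIV. \<gamma> i * (cmod (herm (v a) (e i)))\<^sup>2)"
          by (subst herm_parseval[OF e])
            (simp add: herm_matrix_adjoint[OF A] eig herm_algebra modsq mult.assoc del: of_real_power)
        then show "(\<Sum>i\<in>UNIV. \<gamma> i * (cmod (herm (v a) (e i)))\<^sup>2) = Re (herm (A *v v a) (v a))"
          by simp
      qed
      finally show "c \<le> (\<Sum>a\<in>I. Re (herm (A *v v a) (v a)))" .
    qed
  next
    assume R: ?R
    show ?L
    proof (intro allI impI)
      fix S assume "S \<subseteq># image_mset Re (proots (charpoly A)) \<and> size S = q"
      then obtain I :: "'n set" where S: "S = image_mset \<gamma> (mset_set I)" and "size S = q"
        unfolding ev by (metis submultiset_of_image finite)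
      then have "card I = q" by simp
      moreover have "unitary_on I e" using e by (auto simp: unitary_on_def)
      ultimately have "c \<le> (\<Sum>a\<in>I. Re (herm (A *v e a) (e a)))" using R by blast
      also have "\<dots> = sum \<gamma> I"
        using e by (simp add: eig herm_algebra unitary_on_def)
      finally show "c \<le> \<Sum>\<^sub># S" by (simp add: S sum_unfold_sum_mset)
    qed
  qed
qed

section \<open>Second derivatives and the Levi form\<close>

lemma dderiv_along_line:
  assumes "f differentiable at (p + t *\<^sub>R v)"
  shows "((\<lambda>s. f (p + s *\<^sub>R v)) has_real_derivative frechet_derivative f (at (p + t *\<^sub>R v)) v) (at t)"
proof -
  let ?D = "frechet_derivative f (at (p + t *\<^sub>R v))"
  have D: "(f has_derivative ?D) (at (p + t *\<^sub>R v))"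
    using assms by (simp add: frechet_derivative_works)
  have "((\<lambda>s. p + s *\<^sub>R v) has_derivative (\<lambda>s. s *\<^sub>R v)) (at t)"
    by (auto intro!: derivative_eq_intros)
  from diff_chain_at[OF this D]
  have "((\<lambda>s. f (p + s *\<^sub>R v)) has_derivative (\<lambda>s. ?D (s *\<^sub>R v))) (at t)" by (simp add: o_def)
  moreover have "?D (s *\<^sub>R v) = ?D v * s" for s
    using linear_frechet_derivative[OF assms] by (simp add: linear_scale)
  ultimately show ?thesis by (simp add: has_field_derivative_def)
qed

definition D2 :: "('a::real_normed_vector \<Rightarrow> real) \<Rightarrow> 'a \<Rightarrow> 'a \<Rightarrow> 'a \<Rightarrow> real" where
  "D2 f z u v = frechet_derivative (\<lambda>x. frechet_derivative f (at x) v) (at z) u"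

lemma Ck2D:
  assumes "Ck_on 2 D f"
  shows "x \<in> D \<Longrightarrow> f differentiable (at x)"
    and "x \<in> D \<Longrightarrow> (\<lambda>x. frechet_derivative f (at x) v) differentiable (at x)"
    and "continuous_on D (\<lambda>z. D2 f z u v)"
  using assms by (auto simp: numeral_2_eq_2 D2_def)

lemma linear_D2_left:
  assumes "Ck_on 2 D f" "z \<in> D"
  shows "linear (\<lambda>u. D2 f z u v)"
  using linear_frechet_derivative[OF Ck2D(2)[OF assms]] by (simp add: D2_def)

text \<open>
  The derivative is linear in its direction at every point of \<open>D\<close> only, so differentiating this
  linearity once more at \<open>z\<close> uses that \<open>D\<close> is a neighbourhood of \<open>z\<close>.
\<close>

lemma linear_D2_right:
  assumes C: "Ck_on 2 D f" and "open D" "z \<in> D"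
  shows "linear (D2 f z u)"
proof -
  let ?F = "\<lambda>v x. frechet_derivative f (at x) v"
  have lin: "linear (\<lambda>v. ?F v x)" if "x \<in> D" for x
    using linear_frechet_derivative[OF Ck2D(1)[OF C that]] .
  have has: "(?F v has_derivative (\<lambda>u. D2 f z u v)) (at z)" for v
    using Ck2D(2)[OF C \<open>z \<in> D\<close>, of v] unfolding D2_def frechet_derivative_works .
  show ?thesis
  proof (rule linearI)
    fix v w
    have "((\<lambda>x. ?F v x + ?F w x) has_derivative (\<lambda>u. D2 f z u v + D2 f z u w)) (at z)"
      by (intro has_derivative_add has)
    then have "(?F (v + w) has_derivative (\<lambda>u. D2 f z u v + D2 f z u w)) (at z)"
      by (rule has_derivative_transform_within_open[OF _ assms(2,3)]) (simp add: linear_add[OF lin])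
    from has_derivative_unique[OF has this] show "D2 f z u (v + w) = D2 f z u v + D2 f z u w"
      by meson
  next
    fix r v
    have "((\<lambda>x. r * ?F v x) has_derivative (\<lambda>u. r * D2 f z u v)) (at z)"
      by (intro has_derivative_mult_right has)
    then have "(?F (r *\<^sub>R v) has_derivative (\<lambda>u. r * D2 f z u v)) (at z)"
      by (rule has_derivative_transform_within_open[OF _ assms(2,3)]) (simp add: linear_scale[OF lin])
    from has_derivative_unique[OF has this] show "D2 f z u (r *\<^sub>R v) = r *\<^sub>R D2 f z u v"
      by (metis real_scaleR_def)
  qed
qed

text \<open>
  Two applications of the mean value theorem.  The left side of the equation does not change when \<open>u\<close>
  and \<open>v\<close> are exchanged, but the right side then involves \<open>D2\<close> with exchanged directions, whence the
  symmetry of second derivatives.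
\<close>

lemma mixed_difference_eq_D2:
  assumes C: "Ck_on 2 D f" and "0 < h"
    and sub: "\<And>s t. \<lbrakk>0 \<le> s; s \<le> h; 0 \<le> t; t \<le> h\<rbrakk> \<Longrightarrow> z + s *\<^sub>R u + t *\<^sub>R v \<in> D"
  obtains s t where "0 < s" "s < h" "0 < t" "t < h"
    "f (z + h *\<^sub>R u + h *\<^sub>R v) - f (z + h *\<^sub>R u) - f (z + h *\<^sub>R v) + f z
       = h * h * D2 f (z + s *\<^sub>R u + t *\<^sub>R v) v u"
proof -
  let ?g = "\<lambda>s. f ((z + h *\<^sub>R v) + s *\<^sub>R u) - f (z + s *\<^sub>R u)"
  let ?Fu = "\<lambda>x. frechet_derivative f (at x) u"
  let ?g' = "\<lambda>s. ?Fu ((z + h *\<^sub>R v) + s *\<^sub>R u) - ?Fu (z + s *\<^sub>R u)"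
  have "(?g has_real_derivative ?g' s) (at s)" if "0 \<le> s" "s \<le> h" for s
    using sub[OF that, of h] sub[OF that, of 0] \<open>0 < h\<close>
    by (intro derivative_intros dderiv_along_line Ck2D(1)[OF C]) (auto simp: ac_simps)
  from MVT2[OF \<open>0 < h\<close> this]
  obtain s where s: "0 < s" "s < h" "?g h - ?g 0 = h * ?g' s" by auto
  let ?k = "\<lambda>t. ?Fu ((z + s *\<^sub>R u) + t *\<^sub>R v)"
  have "(?k has_real_derivative D2 f ((z + s *\<^sub>R u) + t *\<^sub>R v) v u) (at t)" if "0 \<le> t" "t \<le> h" for t
    unfolding D2_def
    using sub[of s t] that s by (intro dderiv_along_line Ck2D(2)[OF C]) auto
  from MVT2[OF \<open>0 < h\<close> this]
  obtain t where t: "0 < t" "t < h" "?k h - ?k 0 = h * D2 f ((z + s *\<^sub>R u) + t *\<^sub>R v) v u" by auto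
  have "?g' s = ?k h - ?k 0" by (simp add: ac_simps)
  then show ?thesis using s t by (intro that[of s t]) (auto simp: ac_simps)
qed

text \<open>
  For small \<open>h\<close> the same mixed difference quotient is a value of \<open>D2 f \<cdot> v u\<close> and a value of
  \<open>D2 f \<cdot> u v\<close> at points near \<open>z\<close>; by continuity the two limits at \<open>z\<close> coincide.
\<close>

theorem D2_symmetric:
  fixes f :: "'a::real_normed_vector \<Rightarrow> real"
  assumes C: "Ck_on 2 D f" and "open D" "z \<in> D"
  shows "D2 f z u v = D2 f z v u"
proof (rule ccontr)
  assume neq: "D2 f z u v \<noteq> D2 f z v u"
  define \<epsilon> where "\<epsilon> = \<bar>D2 f z u v - D2 f z v u\<bar> / 2"
  have "\<epsilon> > 0" using neq by (simp add: \<epsilon>_def)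
  have "isCont (\<lambda>x. D2 f x a b) z" for a b
    using Ck2D(3)[OF C] assms(2,3) by (simp add: continuous_on_eq_continuous_at)
  then have cont: "((\<lambda>x. D2 f x a b) \<longlongrightarrow> D2 f z a b) (nhds z)" for a b
    by (intro tendsto_at_iff_tendsto_nhds[of "\<lambda>x. D2 f x a b" z, THEN iffD1]) (simp add: isCont_def)
  have "\<forall>\<^sub>F x in nhds z. x \<in> D \<and> \<bar>D2 f x u v - D2 f z u v\<bar> < \<epsilon> \<and> \<bar>D2 f x v u - D2 f z v u\<bar> < \<epsilon>"
    using tendstoD[OF cont[of u v] \<open>\<epsilon> > 0\<close>] tendstoD[OF cont[of v u] \<open>\<epsilon> > 0\<close>]
      eventually_nhds_in_open[OF assms(2,3)]
    unfolding dist_real_def by eventually_elim blast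
  then obtain d where "d > 0"
    and d: "\<And>x. dist x z < d \<Longrightarrow> x \<in> D \<and> \<bar>D2 f x u v - D2 f z u v\<bar> < \<epsilon> \<and> \<bar>D2 f x v u - D2 f z v u\<bar> < \<epsilon>"
    by (auto simp: eventually_nhds_metric)
  define h where "h = d / (norm u + norm v + 1)"
  have "h > 0" using \<open>d > 0\<close> by (simp add: h_def add_nonneg_pos)
  have near: "dist (z + s *\<^sub>R u + t *\<^sub>R v) z < d" if "0 \<le> s" "s \<le> h" "0 \<le> t" "t \<le> h" for s t
  proof -
    have "dist (z + s *\<^sub>R u + t *\<^sub>R v) z = norm (s *\<^sub>R u + t *\<^sub>R v)" by (simp add: dist_norm)
    also have "\<dots> \<le> s * norm u + t * norm v"
      using norm_triangle_ineq[of "s *\<^sub>R u" "t *\<^sub>R v"] that by simp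
    also have "\<dots> \<le> h * norm u + h * norm v"
      using that by (intro add_mono mult_right_mono) auto
    also have "\<dots> < h * (norm u + norm v + 1)" using \<open>h > 0\<close> by (simp add: algebra_simps)
    also have "\<dots> = d" unfolding h_def using norm_ge_zero[of u] norm_ge_zero[of v]
      by (metis add_nonneg_nonneg add_nonneg_pos less_numeral_extra(1) nonzero_eq_divide_eq order_less_irrefl)
    finally show ?thesis .
  qed
  obtain s t where st: "0 < s" "s < h" "0 < t" "t < h"
    "f (z + h *\<^sub>R u + h *\<^sub>R v) - f (z + h *\<^sub>R u) - f (z + h *\<^sub>R v) + f z
       = h * h * D2 f (z + s *\<^sub>R u + t *\<^sub>R v) v u"
    using mixed_difference_eq_D2[OF C \<open>h > 0\<close>, of z u v] near d by metis
  have near': "dist (z + s *\<^sub>R v + t *\<^sub>R u) z < d" if "0 \<le> s" "s \<le> h" "0 \<le> t" "t \<le> h" for s t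
    using near[OF that(3,4,1,2)] by (simp add: ac_simps)
  obtain s' t' where st': "0 < s'" "s' < h" "0 < t'" "t' < h"
    "f (z + h *\<^sub>R v + h *\<^sub>R u) - f (z + h *\<^sub>R v) - f (z + h *\<^sub>R u) + f z
       = h * h * D2 f (z + s' *\<^sub>R v + t' *\<^sub>R u) u v"
    using mixed_difference_eq_D2[OF C \<open>h > 0\<close>, of z v u] near' d by metis
  have "f (z + h *\<^sub>R u + h *\<^sub>R v) - f (z + h *\<^sub>R u) - f (z + h *\<^sub>R v) + f z
      = f (z + h *\<^sub>R v + h *\<^sub>R u) - f (z + h *\<^sub>R v) - f (z + h *\<^sub>R u) + f z"
    by (simp add: ac_simps)
  then have "D2 f (z + s *\<^sub>R u + t *\<^sub>R v) v u = D2 f (z + s' *\<^sub>R v + t' *\<^sub>R u) u v"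
    using st(5) st'(5) \<open>h > 0\<close> by simp
  moreover have "\<bar>D2 f (z + s *\<^sub>R u + t *\<^sub>R v) v u - D2 f z v u\<bar> < \<epsilon>"
    using d[OF near[of s t]] st by simp
  moreover have "\<bar>D2 f (z + s' *\<^sub>R v + t' *\<^sub>R u) u v - D2 f z u v\<bar> < \<epsilon>"
    using d[OF near'[of s' t']] st' by simp
  ultimately show False unfolding \<epsilon>_def by (simp add: field_simps abs_if split: if_splits)
qed

text \<open>
  The complex Hessian form in the direction \<open>v\<close>, equivalently a quarter of the Laplacian at \<open>0\<close> of the
  function \<open>\<zeta> \<mapsto> f (z + \<zeta> v)\<close> of one complex variable.
\<close>

definition levi :: "(complex^'n \<Rightarrow> real) \<Rightarrow> complex^'n \<Rightarrow> complex^'n \<Rightarrow> real" where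
  "levi f z v = (D2 f z v v + D2 f z (\<i> *s v) (\<i> *s v)) / 4"

lemma complex_hessian_entry:
  assumes C: "Ck_on 2 D f" and D: "open D" "z \<in> D"
  shows "complex_hessian f z $ j $ k =
    (D2 f z (axis j 1) (axis k 1) + D2 f z (axis j \<i>) (axis k \<i>)
      + \<i> * (D2 f z (axis j 1) (axis k \<i>) - D2 f z (axis j \<i>) (axis k 1))) / 4"
proof -
  let ?F = "\<lambda>v x. frechet_derivative f (at x) v"
  let ?f = "\<lambda>x. complex_of_real (f x)"
  have inner: "frechet_derivative ?f (at x) v = of_real (?F v x)" if "x \<in> D" for x v
  proof -
    have "(f has_derivative frechet_derivative f (at x)) (at x)"
      using Ck2D(1)[OF C that] by (simp add: frechet_derivative_works)
    then have "(?f has_derivative (\<lambda>v. of_real (frechet_derivative f (at x) v))) (at x)"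
      by (rule has_derivative_of_real)
    from frechet_derivative_at[OF this] show ?thesis by metis
  qed
  let ?g = "\<lambda>x. (complex_of_real (?F (axis k 1) x) + \<i> * complex_of_real (?F (axis k \<i>) x)) / 2"
  have has: "(?F v has_derivative (\<lambda>u. D2 f z u v)) (at z)" for v
    using Ck2D(2)[OF C \<open>z \<in> D\<close>, of v] unfolding D2_def frechet_derivative_works .
  have "(?g has_derivative (\<lambda>u. (of_real (D2 f z u (axis k 1)) + \<i> * of_real (D2 f z u (axis k \<i>))) / 2)) (at z)"
    by (intro bounded_linear.has_derivative[OF bounded_linear_divide] has_derivative_add
        has_derivative_mult_right has_derivative_of_real has)
  then have "(dzbar k ?f has_derivative
      (\<lambda>u. (of_real (D2 f z u (axis k 1)) + \<i> * of_real (D2 f z u (axis k \<i>))) / 2)) (at z)"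
    by (rule has_derivative_transform_within_open[OF _ D]) (simp add: dzbar_def inner)
  from frechet_derivative_at[OF this, symmetric] show ?thesis
    by (simp add: complex_hessian_def dz_def field_simps)
qed

lemma hermitian_complex_hessian:
  assumes "Ck_on 2 D f" "open D" "z \<in> D"
  shows "hermitian (complex_hessian f z)"
  unfolding hermitian_def complex_hessian_entry[OF assms]
  by (auto simp: complex_eq_iff D2_symmetric[OF assms])

text \<open>
  The Levi form in the direction \<open>v\<close> is \<open>\<Sum>j k. H\<^sub>j\<^sub>k v\<^sub>j cnj v\<^sub>k\<close> with the conjugate on the second index of
  the matrix, whereas \<open>herm (H *v w) w\<close> conjugates the first.  The two match for \<open>w = vcnj v\<close>.
\<close>

definition vcnj :: "complex^'n \<Rightarrow> complex^'n" where
  "vcnj v = (\<chi> i. cnj (v $ i))"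

lemma herm_vcnj: "herm (vcnj v) (vcnj w) = cnj (herm v w)"
  by (simp add: herm_def vcnj_def)

lemma vcnj_vcnj [simp]: "vcnj (vcnj v) = v"
  by (simp add: vcnj_def vec_eq_iff)

lemma unitary_on_vcnj: "unitary_on I v \<Longrightarrow> unitary_on I (\<lambda>a. vcnj (v a))"
  by (simp add: unitary_on_def herm_vcnj)

text \<open>
  Polarize: \<open>H u w\<close> below is complex linear in \<open>u\<close>, conjugate linear in \<open>w\<close>, and takes the matrix entries
  as values on the coordinate axes.  So it is the sesquilinear form of the Hessian, and on the
  diagonal its real part is the Levi form.
\<close>

lemma levi_eq_hessian_form:
  fixes f :: "complex^'n \<Rightarrow> real"
  assumes C: "Ck_on 2 D f" and D: "open D" "z \<in> D"
  shows "levi f z v = Re (herm (complex_hessian f z *v vcnj v) (vcnj v))"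
proof -
  define B where "B = D2 f z"
  define H where "H u w = (complex_of_real (B u w + B (\<i> *s u) (\<i> *s w))
      + \<i> * complex_of_real (B u (\<i> *s w) - B (\<i> *s u) w)) / 4" for u w
  have L: "linear (\<lambda>u. B u w)" "linear (B u)" for u w
    unfolding B_def using linear_D2_left[OF C D(2)] linear_D2_right[OF C D] by auto
  have B_add: "B (x + y) w = B x w + B y w" "B w (x + y) = B w x + B w y" for x y w
    using L linear_add by metis+
  have B_minus: "B (- x) w = - B x w" "B w (- x) = - B w x" for x w
    using L linear_neg by metis+
  have B_diff: "B (x - y) w = B x w - B y w" "B w (x - y) = B w x - B w y" for x y w
    using L linear_diff by metis+
  have B_scale: "B (r *\<^sub>R x) w = r * B x w" "B w (r *\<^sub>R x) = r * B w x" for r x w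
    using linear_scale[OF L(1)[of w]] linear_scale[OF L(2)[of w]] by simp_all
  have H_add: "H (x + y) w = H x w + H y w" "H w (x + y) = H w x + H w y" for x y w
    by (simp_all add: H_def B_add vector_add_ldistrib field_simps)
  have csplit: "c *s x = Re c *\<^sub>R x + Im c *\<^sub>R (\<i> *s x)" for c and x :: "complex^'n"
    by (simp add: vec_eq_iff complex_eq_iff)
  have ii: "\<i> *s (\<i> *s x) = - x" for x :: "complex^'n" by (simp add: vec_eq_iff)
  have iR: "\<i> *s (r *\<^sub>R x) = r *\<^sub>R (\<i> *s x)" for r and x :: "complex^'n"
    by (simp add: vec_eq_iff complex_eq_iff)
  have H_scale: "H (c *s x) w = c * H x w" "H w (c *s x) = cnj c * H w x" for c x w
    by (simp_all add: csplit[of c x] H_def vector_add_ldistrib iR ii B_add B_diff B_scale B_minus complex_eq_iff field_simps)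
  have H_sum: "H (sum g S) w = (\<Sum>a\<in>S. H (g a) w)" "H w (sum g S) = (\<Sum>a\<in>S. H w (g a))" for g w and S :: "'n set"
  proof -
    have "H 0 w = 0" "H w 0 = 0" for w using H_scale(1)[of 0 0 w] H_scale(2)[of w 0 0] by auto
    then show "H (sum g S) w = (\<Sum>a\<in>S. H (g a) w)" "H w (sum g S) = (\<Sum>a\<in>S. H w (g a))"
      by (induction S rule: infinite_finite_induct) (auto simp: H_add)
  qed
  have i_axis: "\<i> *s axis j (1::complex) = axis j \<i>" for j :: 'n
    by (simp add: vec_eq_iff axis_def)
  have entry: "H (axis j 1) (axis k 1) = complex_hessian f z $ j $ k" for j k
    by (simp add: complex_hessian_entry[OF C D] H_def B_def i_axis)
  have "H v v = H (\<Sum>j\<in>UNIV. v $ j *s axis j 1) (\<Sum>k\<in>UNIV. v $ k *s axis k 1)"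
    by (simp add: basis_expansion)
  also have "\<dots> = (\<Sum>j\<in>UNIV. \<Sum>k\<in>UNIV. v $ j * (cnj (v $ k) * complex_hessian f z $ j $ k))"
    unfolding H_sum(1) H_scale(1) unfolding H_sum(2) H_scale(2) entry sum_distrib_left by (rule refl)
  also have "\<dots> = herm (complex_hessian f z *v vcnj v) (vcnj v)"
    by (simp add: herm_def vcnj_def matrix_vector_mult_def sum_distrib_left sum_distrib_right ac_simps)
  finally have "Re (H v v) = Re (herm (complex_hessian f z *v vcnj v) (vcnj v))" by simp
  then show ?thesis by (simp add: H_def levi_def B_def)
qed

text \<open>
  Conjugating all the vectors permutes the unitary families, so the conjugation in
  \<open>levi_eq_hessian_form\<close> is absorbed by the quantifier.
\<close>

theorem q_sums_ge_iff_levi: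
  fixes D :: "(complex^'n) set"
  assumes C: "Ck_on 2 D f" and D: "open D"
  shows "q_sums_ge q c D f \<longleftrightarrow>
    (\<forall>z\<in>D. \<forall>(I :: 'n set) v. card I = q \<and> unitary_on I v \<longrightarrow> c \<le> (\<Sum>a\<in>I. levi f z (v a)))"
proof -
  have "(\<forall>(I :: 'n set) v. card I = q \<and> unitary_on I v \<longrightarrow>
          c \<le> (\<Sum>a\<in>I. Re (herm (complex_hessian f z *v v a) (v a)))) \<longleftrightarrow>
        (\<forall>(I :: 'n set) v. card I = q \<and> unitary_on I v \<longrightarrow> c \<le> (\<Sum>a\<in>I. levi f z (v a)))"
    (is "?L \<longleftrightarrow> ?R") if "z \<in> D" for z
  proof
    assume ?L
    then show ?R using unitary_on_vcnj unfolding levi_eq_hessian_form[OF C D that] by blast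
  next
    assume R: ?R
    show ?L
    proof (intro allI impI)
      fix I :: "'n set" and v :: "'n \<Rightarrow> complex^'n" assume "card I = q \<and> unitary_on I v"
      then have "c \<le> (\<Sum>a\<in>I. levi f z (vcnj (v a)))"
        using R[rule_format, of I "\<lambda>a. vcnj (v a)"] unitary_on_vcnj by blast
      then show "c \<le> (\<Sum>a\<in>I. Re (herm (complex_hessian f z *v v a) (v a)))"
        by (simp add: levi_eq_hessian_form[OF C D that])
    qed
  qed
  from trans[OF ky_fan_lower_bound[OF hermitian_complex_hessian[OF C D]] this]
  show ?thesis unfolding q_sums_ge_def ddbar_eigenvalues_def by (intro ball_cong refl) blast
qed

section \<open>The maximum principle for decreasing limits\<close>

lemma second_derivative_nonpos_at_max:
  fixes g g' :: "real \<Rightarrow> real"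
  assumes "d > 0" and der: "\<And>s. \<bar>s\<bar> < d \<Longrightarrow> (g has_real_derivative g' s) (at s)"
    and der2: "(g' has_real_derivative l) (at 0)"
    and max: "\<And>s. \<bar>s\<bar> < d \<Longrightarrow> g s \<le> g 0"
  shows "l \<le> 0"
proof (rule ccontr)
  assume "\<not> l \<le> 0"
  have "g' 0 = 0"
    using DERIV_local_max[OF der[of 0] \<open>d > 0\<close>] max \<open>d > 0\<close> by simp
  then obtain e where "e > 0" and e: "\<And>h. 0 < h \<Longrightarrow> h < e \<Longrightarrow> 0 < g' h"
    using DERIV_pos_inc_right[OF der2] \<open>\<not> l \<le> 0\<close> by auto
  define x where "x = min d e / 2"
  have x: "0 < x" "x < d" "x < e" using \<open>d > 0\<close> \<open>e > 0\<close> by (auto simp: x_def)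
  have "(g has_real_derivative g' s) (at s)" if "0 \<le> s" "s \<le> x" for s
    using der that x by simp
  from MVT2[OF \<open>0 < x\<close> this] obtain \<xi> where "0 < \<xi>" "\<xi> < x" "g x - g 0 = x * g' \<xi>" by auto
  moreover have "g x \<le> g 0" using max x by simp
  ultimately show False using e[of \<xi>] x by (smt (verit) mult_pos_pos)
qed

text \<open>
  The second derivative test on the line through \<open>p\<close> in the direction \<open>v\<close>.  The quadratic term
  contributes \<open>2 * \<kappa> * (norm v)\<^sup>2\<close> wherever it is centred.
\<close>

lemma D2_le_at_max_of_difference:
  fixes f g :: "'a::real_inner \<Rightarrow> real"
  assumes f: "Ck_on 2 D f" and g: "Ck_on 2 D g" and U: "open U" "p \<in> U" "U \<subseteq> D"
    and max: "\<And>x. x \<in> U \<Longrightarrow>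
      f x - g x - \<kappa> * (norm (x - a))\<^sup>2 \<le> f p - g p - \<kappa> * (norm (p - a))\<^sup>2"
  shows "D2 f p v v \<le> D2 g p v v + 2 * \<kappa> * (norm v)\<^sup>2"
proof -
  obtain e where "e > 0" and e: "ball p e \<subseteq> U" using U open_contains_ball by blast
  define d where "d = e / (norm v + 1)"
  have "d > 0" using \<open>e > 0\<close> by (simp add: d_def add_nonneg_pos)
  have line: "p + s *\<^sub>R v \<in> U" if "\<bar>s\<bar> < d" for s
  proof -
    have "\<bar>s\<bar> * norm v \<le> \<bar>s\<bar> * (norm v + 1)" by (simp add: mult_left_mono)
    also have "\<dots> < e" using that by (simp add: d_def pos_less_divide_eq add_nonneg_pos)
    finally show ?thesis using e by (auto simp: dist_norm)
  qed
  let ?Df = "\<lambda>x. frechet_derivative f (at x) v" and ?Dg = "\<lambda>x. frechet_derivative g (at x) v"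
  define h where "h s = f (p + s *\<^sub>R v) - g (p + s *\<^sub>R v)
    - \<kappa> * ((p - a) \<bullet> (p - a) + 2 * s * ((p - a) \<bullet> v) + s\<^sup>2 * (v \<bullet> v))" for s
  define h' where "h' s = ?Df (p + s *\<^sub>R v) - ?Dg (p + s *\<^sub>R v)
    - \<kappa> * (2 * ((p - a) \<bullet> v) + 2 * s * (v \<bullet> v))" for s
  have h: "h s = f (p + s *\<^sub>R v) - g (p + s *\<^sub>R v) - \<kappa> * (norm (p + s *\<^sub>R v - a))\<^sup>2" for s
  proof -
    have "p + s *\<^sub>R v - a = (p - a) + s *\<^sub>R v" by simp
    then show ?thesis
      unfolding h_def power2_norm_eq_inner
      by (simp only: inner_add_left inner_add_right inner_scaleR_left inner_scaleR_right
          inner_commute[of v "p - a"]) (simp add: algebra_simps power2_eq_square)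
  qed
  have "D2 f p v v - D2 g p v v - \<kappa> * (2 * (v \<bullet> v)) \<le> 0"
  proof (rule second_derivative_nonpos_at_max[OF \<open>d > 0\<close>, of h h'])
    fix s assume "\<bar>s\<bar> < d"
    then have "p + s *\<^sub>R v \<in> D" using line U by blast
    then show "(h has_real_derivative h' s) (at s)"
      unfolding h_def h'_def
      by (intro DERIV_diff dderiv_along_line Ck2D(1)[OF f] Ck2D(1)[OF g])
        (auto intro!: derivative_eq_intros)
    show "h s \<le> h 0" using max[OF line[OF \<open>\<bar>s\<bar> < d\<close>]] by (simp add: h)
  next
    have "p + 0 *\<^sub>R v \<in> D" using U by auto
    then show "(h' has_real_derivative D2 f p v v - D2 g p v v - \<kappa> * (2 * (v \<bullet> v))) (at 0)"
      using dderiv_along_line[OF Ck2D(2)[OF f], of p 0 v v] dderiv_along_line[OF Ck2D(2)[OF g], of p 0 v v]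
      unfolding h'_def D2_def
      by (intro DERIV_diff) (auto intro!: derivative_eq_intros)
  qed
  then show ?thesis by (simp add: power2_norm_eq_inner)
qed

lemma levi_le_at_max_of_difference:
  fixes f g :: "complex^'n \<Rightarrow> real"
  assumes "Ck_on 2 D f" "Ck_on 2 D g" "open U" "p \<in> U" "U \<subseteq> D"
    and "\<And>x. x \<in> U \<Longrightarrow>
      f x - g x - \<kappa> * (norm (x - a))\<^sup>2 \<le> f p - g p - \<kappa> * (norm (p - a))\<^sup>2"
  shows "levi f p v \<le> levi g p v + \<kappa> * (norm v)\<^sup>2"
proof -
  have "D2 f p w w \<le> D2 g p w w + 2 * \<kappa> * (w \<bullet> w)" for w
    using D2_le_at_max_of_difference[of D f g U p \<kappa> a w] assms by (simp add: power2_norm_eq_inner)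
  from this[of v] this[of "\<i> *s v"] show ?thesis
    by (simp add: levi_def power2_norm_eq_inner herm_algebra field_simps flip: Re_herm)
qed

text \<open>
  Pointwise monotone convergence suffices on the sphere: the compact sets where
  \<open>\<psi> j - \<phi> \<ge> \<kappa> * r\<^sup>2\<close> decrease with \<open>j\<close> and have empty intersection, so one of them is empty.  For that \<open>j\<close>
  the penalized difference is negative on the sphere but nonnegative at the centre.
\<close>

lemma decreasing_limit_interior_max:
  fixes \<psi> :: "nat \<Rightarrow> 'a::euclidean_space \<Rightarrow> real"
  assumes "r > 0" "\<kappa> > 0" and \<phi>: "continuous_on (cball a r) \<phi>" and \<psi>: "\<And>j. continuous_on (cball a r) (\<psi> j)"
    and dec: "\<And>x. x \<in> cball a r \<Longrightarrow> decseq (\<lambda>j. \<psi> j x)"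
    and lim: "\<And>x. x \<in> cball a r \<Longrightarrow> (\<lambda>j. \<psi> j x) \<longlonglongrightarrow> \<phi> x"
  obtains j p where "p \<in> ball a r"
    "\<And>x. x \<in> cball a r \<Longrightarrow> \<psi> j x - \<phi> x - \<kappa> * (dist x a)\<^sup>2 \<le> \<psi> j p - \<phi> p - \<kappa> * (dist p a)\<^sup>2"
proof -
  define F where "F j = {x \<in> sphere a r. \<kappa> * r\<^sup>2 \<le> \<psi> j x - \<phi> x}" for j
  have sub: "sphere a r \<subseteq> cball a r" by auto
  have "compact (F j)" for j
  proof -
    have "closed (sphere a r \<inter> (\<lambda>x. \<psi> j x - \<phi> x) -` {\<kappa> * r\<^sup>2..})"
      by (intro continuous_closed_preimage continuous_on_diff
          continuous_on_subset[OF \<phi> sub] continuous_on_subset[OF \<psi> sub]) auto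
    moreover have "F j = sphere a r \<inter> (\<lambda>x. \<psi> j x - \<phi> x) -` {\<kappa> * r\<^sup>2..}"
      by (auto simp: F_def)
    ultimately show ?thesis
      by (metis bounded_Int bounded_sphere compact_eq_bounded_closed)
  qed
  moreover have "F n \<subseteq> F m" if "m \<le> n" for m n
    using decseqD[OF dec that] sub unfolding F_def by force
  moreover have "\<Inter>(range F) = {}"
  proof (rule equals0I)
    fix x assume x: "x \<in> \<Inter>(range F)"
    then have "x \<in> sphere a r" by (auto simp: F_def)
    then have "(\<lambda>j. \<psi> j x - \<phi> x) \<longlonglongrightarrow> \<phi> x - \<phi> x"
      using sub by (intro tendsto_diff lim) auto
    moreover have "\<kappa> * r\<^sup>2 \<le> \<psi> j x - \<phi> x" for j using x by (auto simp: F_def)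
    ultimately have "\<kappa> * r\<^sup>2 \<le> \<phi> x - \<phi> x" by (intro LIMSEQ_le_const) auto
    moreover have "0 < \<kappa> * r\<^sup>2" using assms(1,2) by simp
    ultimately show False by simp
  qed
  ultimately obtain j where j: "F j = {}" using compact_nest[of F] by blast
  let ?h = "\<lambda>x. \<psi> j x - \<phi> x - \<kappa> * (dist x a)\<^sup>2"
  have "continuous_on (cball a r) ?h" by (intro continuous_intros \<phi> \<psi>)
  then obtain p where p: "p \<in> cball a r" "\<And>x. x \<in> cball a r \<Longrightarrow> ?h x \<le> ?h p"
    using continuous_attains_sup[of "cball a r" ?h] \<open>r > 0\<close> by auto
  have "0 \<le> ?h a" using decseq_ge[OF dec lim, of a j] \<open>r > 0\<close> by simp
  moreover have "?h a \<le> ?h p" using p(2)[of a] \<open>r > 0\<close> by simp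
  moreover have "?h p < 0" if "p \<in> sphere a r"
  proof -
    have "\<psi> j p - \<phi> p < \<kappa> * r\<^sup>2" using j that by (auto simp: F_def not_le)
    then show ?thesis using that by (simp add: dist_commute)
  qed
  ultimately have "p \<notin> sphere a r" by linarith
  then have "p \<in> ball a r" using p(1) by auto
  then show ?thesis using p(2) that by blast
qed

theorem theorem4p1:
  fixes D :: "(complex^'n) set" and q :: nat and c :: real
    and \<phi> :: "complex^'n \<Rightarrow> real" and \<psi> :: "nat \<Rightarrow> complex^'n \<Rightarrow> real"
  assumes "bounded D" and "pseudoconvex_domain D"
    and "1 \<le> q" and "q \<le> CARD('n)" and "c \<ge> 0"
    and "smooth_on D \<phi>"
    and "\<And>j. smooth_on D (\<psi> j)"
    and "\<And>z. z \<in> D \<Longrightarrow> decseq (\<lambda>j. \<psi> j z)"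
    and "\<And>z. z \<in> D \<Longrightarrow> (\<lambda>j. \<psi> j z) \<longlonglongrightarrow> \<phi> z"
    and "\<And>j. q_sums_ge q c D (\<psi> j)"
  shows "q_sums_ge q c D \<phi>"
proof -
  have D: "open D"
    using assms(2) by (simp add: pseudoconvex_domain_def pseudoconvex_def)
  have C\<phi>: "Ck_on 2 D \<phi>" and C\<psi>: "Ck_on 2 D (\<psi> j)" for j
    using assms(6,7) by (auto simp: smooth_on_def)
  have cont: "continuous_on D f" if "Ck_on 2 D f" for f :: "complex^'n \<Rightarrow> real"
    using Ck2D(1)[OF that] by (intro differentiable_imp_continuous_on)
      (simp add: differentiable_on_def differentiable_at_withinI)
  have "c \<le> (\<Sum>a\<in>I. levi \<phi> z (v a))"
    if z: "z \<in> D" and I: "card I = q" and v: "unitary_on I v" for z and I :: "'n set" and v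
  proof (rule ccontr)
    define T where "T f x = (\<Sum>a\<in>I. levi f x (v a))" for f x
    assume "\<not> c \<le> (\<Sum>a\<in>I. levi \<phi> z (v a))"
    then have neg: "T \<phi> z < c" by (simp add: T_def)
    \<comment> \<open>Half of the gap, shared equally among the \<open>q\<close> directions.\<close>
    define \<kappa> where "\<kappa> = (c - T \<phi> z) / (2 * q)"
    have "\<kappa> > 0" using neg \<open>1 \<le> q\<close> by (simp add: \<kappa>_def)
    have q\<kappa>: "q * \<kappa> = (c - T \<phi> z) / 2" using \<open>1 \<le> q\<close> by (simp add: \<kappa>_def)
    have "continuous_on D (T \<phi>)"
      unfolding T_def levi_def by (intro continuous_intros Ck2D(3)[OF C\<phi>]) auto
    then have "open (D \<inter> T \<phi> -` {..<c - q * \<kappa>})"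
      using D by (intro continuous_open_preimage) auto
    moreover have "z \<in> D \<inter> T \<phi> -` {..<c - q * \<kappa>}"
    proof -
      have "T \<phi> z < c - q * \<kappa>" unfolding q\<kappa> using neg by (simp add: field_simps)
      then show ?thesis using z by simp
    qed
    ultimately obtain r where "r > 0" and r: "cball z r \<subseteq> D \<inter> T \<phi> -` {..<c - q * \<kappa>}"
      using open_contains_cball by metis
    then have sub: "cball z r \<subseteq> D" by blast
    obtain j p where p: "p \<in> ball z r" and max: "\<And>x. x \<in> cball z r \<Longrightarrow>
        \<psi> j x - \<phi> x - \<kappa> * (dist x z)\<^sup>2 \<le> \<psi> j p - \<phi> p - \<kappa> * (dist p z)\<^sup>2"
      using decreasing_limit_interior_max[OF \<open>r > 0\<close> \<open>\<kappa> > 0\<close>, of z \<phi> \<psi>]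
        continuous_on_subset[OF cont[OF C\<phi>] sub] continuous_on_subset[OF cont[OF C\<psi>] sub]
        assms(8,9) sub by (smt (verit) subsetD)
    have "p \<in> D" using p sub by auto
    have "T (\<psi> j) p \<le> (\<Sum>a\<in>I. levi \<phi> p (v a) + \<kappa>)"
      unfolding T_def
    proof (rule sum_mono)
      fix a assume "a \<in> I"
      then have "(norm (v a))\<^sup>2 = 1"
        using v herm_self[of "v a"] by (simp add: unitary_on_def flip: of_real_power)
      moreover have "levi (\<psi> j) p (v a) \<le> levi \<phi> p (v a) + \<kappa> * (norm (v a))\<^sup>2"
        using max sub by (intro levi_le_at_max_of_difference[where a = z, OF C\<psi> C\<phi> open_ball p])
          (auto simp: dist_norm)
      ultimately show "levi (\<psi> j) p (v a) \<le> levi \<phi> p (v a) + \<kappa>" by simp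
    qed
    also have "\<dots> = T \<phi> p + q * \<kappa>" using I by (simp add: T_def sum.distrib)
    also have "\<dots> < c"
    proof -
      have "p \<in> cball z r" using p by simp
      then have "T \<phi> p < c - q * \<kappa>" using r by blast
      then show ?thesis by linarith
    qed
    finally have "T (\<psi> j) p < c" .
    moreover have "c \<le> T (\<psi> j) p"
      using assms(10)[of j] \<open>p \<in> D\<close> I v unfolding q_sums_ge_iff_levi[OF C\<psi> D] T_def by blast
    ultimately show False by simp
  qed
  then show ?thesis unfolding q_sums_ge_iff_levi[OF C\<phi> D] by blast
qed

end
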